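(* For every $n\ge 1$, $$\sum_{\sigma\in B_n} \mathrm{sign}(|\sigma|)\, q^{\mathrm{fmaj}(\sigma)} = [2]_{q}[4]_{-q}\cdots[2n]_{(-1)^{n-1}q}.$$
   Context: $B_n$ is the group of signed permutations of $[n]$. For $\sigma\in B_n$, $\mathrm{sign}(|\sigma|)$ is the sign of the permutation $(|\sigma(1)|,\dots,|\sigma(n)|)\in S_n$. $[n]_q=(1-q^n)/(1-q)$. $\mathrm{neg}(\sigma)=\#\{i:\sigma(i)<0\}$; $\mathrm{fmaj}(\sigma)=2\,\mathrm{maj}(\sigma)+\mathrm{neg}(\sigma)$ with $\mathrm{maj}$ the major index of $(\sigma(1),\dots,\sigma(n))$ with respect to the order $-1<\cdots<-n<1<\cdots<n$. *)

theory Defs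
  imports "HOL-Combinatorics.Permutations" "HOL-Computational_Algebra.Polynomial"
begin

text \<open>Signed permutations of \<open>{1, \<dots>, n}\<close>, as bijections \<open>\<sigma>\<close> of \<open>{-n, \<dots>, -1, 1, \<dots>, n}\<close> with
  \<open>\<sigma> (- i) = - \<sigma> i\<close>, extended by the identity to all integers.\<close>

definition signed_perms :: "nat \<Rightarrow> (int \<Rightarrow> int) set" where
  "signed_perms n =
     {\<sigma>. \<sigma> permutes ({- int n..int n} - {0}) \<and> (\<forall>i. \<sigma> (- i) = - \<sigma> i)}"

definition abs_perm :: "(int \<Rightarrow> int) \<Rightarrow> nat \<Rightarrow> nat" where
  "abs_perm \<sigma> i = nat \<bar>\<sigma> (int i)\<bar>"

text \<open>The strict order \<open>-1 < -2 < \<dots> < -n < 1 < 2 < \<dots> < n\<close> on nonzero integers.\<close>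

definition signed_less :: "int \<Rightarrow> int \<Rightarrow> bool" where
  "signed_less a b \<longleftrightarrow>
     a < 0 \<and> 0 < b \<or> a < 0 \<and> b < 0 \<and> \<bar>a\<bar> < \<bar>b\<bar> \<or> 0 < a \<and> 0 < b \<and> a < b"

definition descents :: "nat \<Rightarrow> (int \<Rightarrow> int) \<Rightarrow> nat set" where
  "descents n \<sigma> = {i \<in> {1..<n}. signed_less (\<sigma> (int (i + 1))) (\<sigma> (int i))}"

definition maj :: "nat \<Rightarrow> (int \<Rightarrow> int) \<Rightarrow> nat" where
  "maj n \<sigma> = \<Sum>(descents n \<sigma>)"

definition neg :: "nat \<Rightarrow> (int \<Rightarrow> int) \<Rightarrow> nat" where
  "neg n \<sigma> = card {i \<in> {1..n}. \<sigma> (int i) < 0}"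

definition fmaj :: "nat \<Rightarrow> (int \<Rightarrow> int) \<Rightarrow> nat" where
  "fmaj n \<sigma> = 2 * maj n \<sigma> + neg n \<sigma>"

text \<open>The division is exact whenever \<open>x \<noteq> 1\<close>; see \<open>q_int_eq_sum\<close> below.\<close>

definition q_int :: "nat \<Rightarrow> 'a :: idom_divide \<Rightarrow> 'a" where
  "q_int m x = (1 - x ^ m) div (1 - x)"

lemma q_int_eq_sum:
  fixes x :: "'a :: idom_divide"
  assumes "x \<noteq> 1"
  shows "q_int m x = (\<Sum>i<m. x ^ i)"
proof -
  have "1 - x \<noteq> 0" using assms by simp
  moreover have "1 - x ^ m = (1 - x) * (\<Sum>i<m. x ^ i)" by (rule one_diff_power_eq)
  ultimately show ?thesis by (simp add: q_int_def)
qed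

lemma finite_signed_perms: "finite (signed_perms n)"
proof (rule finite_subset)
  show "signed_perms n \<subseteq> {\<sigma>. \<sigma> permutes ({- int n..int n} - {0})}"
    by (auto simp: signed_perms_def)
qed (rule finite_permutations, simp)

lemma abs_perm_permutes:
  assumes "\<sigma> \<in> signed_perms n"
  shows "abs_perm \<sigma> permutes {1..n}"
proof (rule bij_imp_permutes)
  have p: "\<sigma> permutes ({- int n..int n} - {0})" and odd: "\<And>i. \<sigma> (- i) = - \<sigma> i"
    using assms by (auto simp: signed_perms_def)
  have "inj_on (abs_perm \<sigma>) {1..n}"
  proof (rule inj_onI)
    fix i j assume ij: "i \<in> {1..n}" "j \<in> {1..n}" and "abs_perm \<sigma> i = abs_perm \<sigma> j"
    then have "\<bar>\<sigma> (int i)\<bar> = \<bar>\<sigma> (int j)\<bar>" by (simp add: abs_perm_def)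
    then have "\<sigma> (int i) = \<sigma> (int j) \<or> \<sigma> (int i) = \<sigma> (- int j)"
      by (auto simp: odd abs_eq_iff)
    then have "int i = int j \<or> int i = - int j"
      by (simp only: inj_eq[OF permutes_inj[OF p]])
    then show "i = j" using ij by auto
  qed
  moreover have "abs_perm \<sigma> ` {1..n} \<subseteq> {1..n}"
  proof
    fix k assume "k \<in> abs_perm \<sigma> ` {1..n}"
    then obtain i where i: "i \<in> {1..n}" "k = nat \<bar>\<sigma> (int i)\<bar>" by (auto simp: abs_perm_def)
    then have "int i \<in> {- int n..int n} - {0}" by auto
    then have "\<sigma> (int i) \<in> {- int n..int n} - {0}" using permutes_in_image[OF p] by blast
    then show "k \<in> {1..n}" using i by auto
  qed
  ultimately show "bij_betw (abs_perm \<sigma>) {1..n} {1..n}"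
    by (simp add: bij_betw_def endo_inj_surj)
next
  fix i assume "i \<notin> {1..n}"
  then have "int i \<notin> {- int n..int n} - {0}" by auto
  moreover have "\<sigma> permutes ({- int n..int n} - {0})"
    using assms by (simp add: signed_perms_def)
  ultimately have "\<sigma> (int i) = int i" by (rule permutes_not_in[rotated])
  then show "abs_perm \<sigma> i = i" by (simp add: abs_perm_def)
qed

end

theory Submission
  imports Defs
begin

text \<open>Listed in decreasing order, the letters \<open>n, \<dots>, 1, -n, \<dots>, -1\<close> are permuted cyclically by a
  signed permutation \<open>c\<close> of order \<open>2n\<close>, for which \<open>|c|\<close> is an \<open>n\<close>-cycle. Composing \<open>\<sigma>\<close> with \<open>c\<close>
  on the left preserves the relative order of all letters except that the minimum \<open>-1\<close>, if present,
  becomes the maximum \<open>n\<close>. Hence it raises the flag major index by exactly one unless \<open>-1\<close> is the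
  last letter. Every element of \<open>B\<^sub>n\<close> is uniquely \<open>c\<^sup>k \<circ> \<sigma>\<close> with \<open>k < 2n\<close> and \<open>\<sigma> \<in> B\<^sub>n\<^sub>-\<^sub>1\<close>, where
  \<open>k\<close> is read off the last letter; so passing from \<open>n - 1\<close> to \<open>n\<close> multiplies the signed sum by
  \<open>\<Sum>k<2n. ((-1)\<^sup>n\<^sup>-\<^sup>1 q)\<^sup>k\<close>.\<close>

definition letter_shift :: "nat \<Rightarrow> int \<Rightarrow> int" where
  "letter_shift n v =
     (if v = 1 then - int n else if v = - 1 then int n
      else if 2 \<le> v \<and> v \<le> int n then v - 1
      else if - int n \<le> v \<and> v \<le> - 2 then v + 1 else v)"

section \<open>The group of signed permutations\<close>

lemma signed_perms_permutes:
  "\<sigma> \<in> signed_perms n \<Longrightarrow> \<sigma> permutes ({- int n..int n} - {0})"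
  by (simp add: signed_perms_def)

lemma signed_perms_uminus: "\<sigma> \<in> signed_perms n \<Longrightarrow> \<sigma> (- i) = - \<sigma> i"
  by (simp add: signed_perms_def)

lemma signed_perms_inj: "\<sigma> \<in> signed_perms n \<Longrightarrow> \<sigma> i = \<sigma> j \<longleftrightarrow> i = j"
  using permutes_inj[OF signed_perms_permutes] by (auto simp: inj_eq)

lemma signed_perms_image:
  assumes "\<sigma> \<in> signed_perms n" and "i \<noteq> 0" and "\<bar>i\<bar> \<le> int n"
  shows "\<sigma> i \<noteq> 0 \<and> \<bar>\<sigma> i\<bar> \<le> int n"
proof -
  have "\<sigma> i \<in> {- int n..int n} - {0}"
    using assms permutes_in_image[OF signed_perms_permutes[OF assms(1)], of i] by auto
  then show ?thesis by auto
qed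

lemma id_in_signed_perms: "id \<in> signed_perms n"
  by (simp add: signed_perms_def permutes_id)

lemma signed_perms_compose:
  "\<sigma> \<in> signed_perms n \<Longrightarrow> \<tau> \<in> signed_perms n \<Longrightarrow> \<sigma> \<circ> \<tau> \<in> signed_perms n"
  by (auto simp: signed_perms_def intro: permutes_compose)

lemma signed_perms_funpow: "\<sigma> \<in> signed_perms n \<Longrightarrow> \<sigma> ^^ k \<in> signed_perms n"
  by (induction k) (simp_all add: id_in_signed_perms signed_perms_compose flip: id_def)

lemma signed_perms_inv:
  assumes "\<sigma> \<in> signed_perms n"
  shows "inv \<sigma> \<in> signed_perms n"
proof -
  have p: "\<sigma> permutes ({- int n..int n} - {0})"
    using assms by (rule signed_perms_permutes)
  have "inv \<sigma> (- i) = - inv \<sigma> i" for i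
  proof -
    have "\<sigma> (- inv \<sigma> i) = - i"
      using permutes_inverses(1)[OF p] signed_perms_uminus[OF assms] by simp
    then show ?thesis using permutes_inverses(2)[OF p] by metis
  qed
  then show ?thesis using permutes_inv[OF p] by (simp add: signed_perms_def)
qed

lemma signed_perms_0: "signed_perms 0 = {id}"
  by (auto simp: signed_perms_def)

text \<open>Signed permutations are the identity outside their letters, so the smaller group is
  literally a subset of the larger one, namely the stabilizer of the top letter. The induction on
  \<open>n\<close> thus needs no explicit embedding.\<close>

lemma signed_perms_fixing_last:
  "\<sigma> \<in> signed_perms n \<longleftrightarrow> \<sigma> \<in> signed_perms (Suc n) \<and> \<sigma> (int (Suc n)) = int (Suc n)"
proof
  assume s: "\<sigma> \<in> signed_perms n"
  have "\<sigma> permutes ({- int (Suc n)..int (Suc n)} - {0})"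
    by (rule permutes_subset[OF signed_perms_permutes[OF s]]) auto
  moreover have "\<sigma> (int (Suc n)) = int (Suc n)"
    by (rule permutes_not_in[OF signed_perms_permutes[OF s]]) auto
  ultimately show "\<sigma> \<in> signed_perms (Suc n) \<and> \<sigma> (int (Suc n)) = int (Suc n)"
    using signed_perms_uminus[OF s] by (simp add: signed_perms_def)
next
  assume s: "\<sigma> \<in> signed_perms (Suc n) \<and> \<sigma> (int (Suc n)) = int (Suc n)"
  then have p: "\<sigma> permutes ({- int (Suc n)..int (Suc n)} - {0})"
    by (intro signed_perms_permutes) simp
  have m: "\<sigma> (- int (Suc n)) = - int (Suc n)"
    using s signed_perms_uminus by metis
  have "\<sigma> permutes ({- int n..int n} - {0})"
  proof (rule permutes_superset[OF p])
    fix x assume "x \<in> {- int (Suc n)..int (Suc n)} - {0} - ({- int n..int n} - {0})"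
    then have "x = int (Suc n) \<or> x = - int (Suc n)" by auto
    then show "\<sigma> x = x" using s m by blast
  qed
  then show "\<sigma> \<in> signed_perms n"
    using signed_perms_uminus[OF conjunct1[OF s]] by (simp add: signed_perms_def)
qed

section \<open>The cycle \<open>letter_shift n\<close> and the sign of its absolute value\<close>

lemma letter_shift_in_signed_perms:
  assumes "n \<ge> 1"
  shows "letter_shift n \<in> signed_perms n"
proof -
  have "letter_shift n permutes ({- int n..int n} - {0})"
  proof (rule bij_imp_permutes)
    have "inj_on (letter_shift n) ({- int n..int n} - {0})"
      using assms by (auto simp: inj_on_def letter_shift_def split: if_splits)
    moreover have "letter_shift n ` ({- int n..int n} - {0}) \<subseteq> {- int n..int n} - {0}"
      using assms by (auto simp: letter_shift_def)
    ultimately show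
      "bij_betw (letter_shift n) ({- int n..int n} - {0}) ({- int n..int n} - {0})"
      by (simp add: bij_betw_def endo_inj_surj)
  next
    fix v assume "v \<notin> {- int n..int n} - {0}"
    then show "letter_shift n v = v" using assms by (auto simp: letter_shift_def)
  qed
  then show ?thesis by (auto simp: signed_perms_def letter_shift_def)
qed

text \<open>Since \<open>\<sigma>\<close> is odd, the absolute value of \<open>\<sigma> v\<close>
  depends only on that of \<open>v\<close>. Hence \<open>abs_perm\<close> is multiplicative, and so
  is the sign weight.\<close>

lemma abs_perm_compose:
  assumes "\<sigma> \<in> signed_perms n"
  shows "abs_perm (\<sigma> \<circ> \<tau>) = abs_perm \<sigma> \<circ> abs_perm \<tau>"
proof
  fix i
  have "\<bar>\<sigma> (\<tau> (int i))\<bar> = \<bar>\<sigma> \<bar>\<tau> (int i)\<bar>\<bar>"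
    using signed_perms_uminus[OF assms, of "\<tau> (int i)"] by (simp add: abs_if)
  then show "abs_perm (\<sigma> \<circ> \<tau>) i = (abs_perm \<sigma> \<circ> abs_perm \<tau>) i"
    by (simp add: abs_perm_def)
qed

lemma permutation_abs_perm: "\<sigma> \<in> signed_perms n \<Longrightarrow> permutation (abs_perm \<sigma>)"
  using abs_perm_permutes by (auto simp: permutation_permutes)

lemma sign_abs_perm_compose:
  assumes "\<sigma> \<in> signed_perms n" and "\<tau> \<in> signed_perms n"
  shows "sign (abs_perm (\<sigma> \<circ> \<tau>)) = sign (abs_perm \<sigma>) * sign (abs_perm \<tau>)"
  using assms by (simp add: abs_perm_compose sign_compose permutation_abs_perm)

lemma abs_perm_id: "abs_perm id = id"
  by (auto simp: abs_perm_def)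

text \<open>Enlarging the cycle by one letter composes its absolute value with a transposition of
  the two top letters, which flips the sign.\<close>

lemma sign_abs_perm_letter_shift: "sign (abs_perm (letter_shift (Suc n))) = (- 1) ^ n"
proof (induction n)
  case 0
  have "abs_perm (letter_shift (Suc 0)) = id"
    by (auto simp: fun_eq_iff abs_perm_def letter_shift_def)
  then show ?case by (simp add: sign_id)
next
  case (Suc n)
  have "abs_perm (letter_shift (Suc (Suc n)))
      = Transposition.transpose (Suc n) (Suc (Suc n)) \<circ> abs_perm (letter_shift (Suc n))"
    by (auto simp: fun_eq_iff abs_perm_def letter_shift_def Transposition.transpose_def
        nat_eq_iff split: if_splits)
  moreover have "permutation (abs_perm (letter_shift (Suc n)))"
    by (rule permutation_abs_perm[OF letter_shift_in_signed_perms]) simp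
  ultimately show ?case
    using Suc by (simp only: sign_compose permutation_swap_id sign_swap_id) simp
qed

lemma sign_abs_perm_letter_shift_funpow:
  "sign (abs_perm (letter_shift (Suc n) ^^ k)) = ((- 1) ^ n) ^ k"
proof (induction k)
  case 0
  then show ?case by (simp add: abs_perm_id sign_id flip: id_def)
next
  case (Suc k)
  have "letter_shift (Suc n) \<in> signed_perms (Suc n)"
    by (rule letter_shift_in_signed_perms) simp
  then show ?case
    using Suc by (simp only: funpow.simps power_Suc sign_abs_perm_compose signed_perms_funpow
        sign_abs_perm_letter_shift)
qed

text \<open>The orbit of \<open>n\<close> runs down \<open>n, ..., 1\<close> and then through
  \<open>-n, ..., -1\<close>. Its values are distinct for \<open>k < 2 * n\<close>, and
  \<open>-1\<close> is reached only at \<open>k = 2 * n - 1\<close>.\<close>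

lemma letter_shift_funpow_last:
  "k < 2 * n \<Longrightarrow>
    (letter_shift n ^^ k) (int n) = (if k < n then int n - int k else int k - 2 * int n)"
proof (induction k)
  case 0
  then show ?case by simp
next
  case (Suc k)
  then show ?case by (auto simp: letter_shift_def)
qed

section \<open>Effect of the cycle on the flag major index\<close>

lemma signed_less_letter_shift:
  assumes "a \<noteq> 0" "\<bar>a\<bar> \<le> int n" "a \<noteq> - 1" "b \<noteq> 0" "\<bar>b\<bar> \<le> int n" "b \<noteq> - 1"
  shows "signed_less (letter_shift n a) (letter_shift n b) \<longleftrightarrow> signed_less a b"
  using assms by (auto simp: signed_less_def letter_shift_def)

lemma signed_perms_preimage_unit:
  assumes s: "\<sigma> \<in> signed_perms n" and n: "n \<ge> 1"
  obtains p where "p \<in> {1..n}" and "\<bar>\<sigma> (int p)\<bar> = 1"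
proof -
  have "1 \<in> {1..n}" using n by simp
  then obtain p where "p \<in> {1..n}" "abs_perm \<sigma> p = 1"
    using permutes_image[OF abs_perm_permutes[OF s]] by (metis imageE)
  then show thesis using that by (auto simp: abs_perm_def nat_eq_iff)
qed

text \<open>Only the letter of absolute value 1, at position \<open>p\<close>, changes sign. If it
  is \<open>1\<close>, no descent changes and \<open>neg\<close> grows by one. If it is
  \<open>-1\<close>, then \<open>neg\<close> drops by one while \<open>maj\<close> grows by one, a
  net change of \<open>2 - 1 = 1\<close>.\<close>

lemma fmaj_letter_shift:
  assumes s: "\<sigma> \<in> signed_perms n" and n: "n \<ge> 1" and last: "\<sigma> (int n) \<noteq> - 1"
  shows "fmaj n (letter_shift n \<circ> \<sigma>) = fmaj n \<sigma> + 1"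
proof -
  let ?\<tau> = "letter_shift n \<circ> \<sigma>"
  obtain p where p: "p \<in> {1..n}" and abs_p: "\<bar>\<sigma> (int p)\<bar> = 1"
    using signed_perms_preimage_unit[OF s n] .
  have range: "\<sigma> (int i) \<noteq> 0 \<and> \<bar>\<sigma> (int i)\<bar> \<le> int n" if "i \<in> {1..n}" for i
    using signed_perms_image[OF s, of "int i"] that by simp
  have other: "\<bar>\<sigma> (int i)\<bar> \<noteq> 1" if "i \<in> {1..n}" "i \<noteq> p" for i
  proof
    assume "\<bar>\<sigma> (int i)\<bar> = 1"
    then have "\<sigma> (int i) = \<sigma> (int p) \<or> \<sigma> (int i) = \<sigma> (- int p)"
      using abs_p signed_perms_uminus[OF s, of "int p"] by linarith
    then show False using that p by (auto simp: signed_perms_inj[OF s])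
  qed
  have neg_other: "?\<tau> (int i) < 0 \<longleftrightarrow> \<sigma> (int i) < 0" if "i \<in> {1..n}" "i \<noteq> p" for i
    using range[OF that(1)] other[OF that] by (auto simp: letter_shift_def)
  \<comment> \<open>The premise is an implication because positions outside \<open>{1..<n}\<close>
    are never descents, so nothing has to be known about their letters.\<close>
  have desc_other: "i \<in> descents n ?\<tau> \<longleftrightarrow> i \<in> descents n \<sigma>"
    if "i \<in> {1..<n} \<longrightarrow> \<sigma> (int i) \<noteq> - 1 \<and> \<sigma> (int (i + 1)) \<noteq> - 1" for i
  proof (cases "i \<in> {1..<n}")
    case True
    then show ?thesis
      using that range[of i] range[of "i + 1"]
        signed_less_letter_shift[of "\<sigma> (int (i + 1))" n "\<sigma> (int i)"]
      by (simp add: descents_def)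
  qed (auto simp: descents_def)
  consider "\<sigma> (int p) = 1" | "\<sigma> (int p) = - 1" using abs_p by linarith
  then show ?thesis
  proof cases
    case 1
    have no: "\<sigma> (int i) \<noteq> - 1" if "i \<in> {1..n}" for i
      using other[OF that] 1 by (cases "i = p") auto
    have "descents n ?\<tau> = descents n \<sigma>"
    proof (rule set_eqI, rule desc_other, intro impI)
      fix i assume "i \<in> {1..<n}"
      then show "\<sigma> (int i) \<noteq> - 1 \<and> \<sigma> (int (i + 1)) \<noteq> - 1"
        using no[of i] no[of "i + 1"] by simp
    qed
    moreover have "{i \<in> {1..n}. ?\<tau> (int i) < 0} = insert p {i \<in> {1..n}. \<sigma> (int i) < 0}"
    proof (rule set_eqI)
      fix i
      have "?\<tau> (int p) < 0" using 1 n by (simp add: letter_shift_def)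
      then show "i \<in> {i \<in> {1..n}. ?\<tau> (int i) < 0} \<longleftrightarrow>
          i \<in> insert p {i \<in> {1..n}. \<sigma> (int i) < 0}"
        using neg_other[of i] p by (cases "i = p") auto
    qed
    moreover have "p \<notin> {i \<in> {1..n}. \<sigma> (int i) < 0}" using 1 by simp
    ultimately show ?thesis by (simp add: fmaj_def maj_def neg_def)
  next
    case 2
    then have "p < n" using p last by (cases "p = n") auto
    have \<tau>p: "?\<tau> (int p) = int n" using 2 by (simp add: letter_shift_def)
    have "{i \<in> {1..n}. \<sigma> (int i) < 0} = insert p {i \<in> {1..n}. ?\<tau> (int i) < 0}"
    proof (rule set_eqI)
      fix i
      show "i \<in> {i \<in> {1..n}. \<sigma> (int i) < 0} \<longleftrightarrow>
          i \<in> insert p {i \<in> {1..n}. ?\<tau> (int i) < 0}"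
        using neg_other[of i] p 2 by (cases "i = p") auto
    qed
    moreover have "p \<notin> {i \<in> {1..n}. ?\<tau> (int i) < 0}" using \<tau>p by simp
    ultimately have neg: "neg n \<sigma> = neg n ?\<tau> + 1" by (simp add: neg_def)
    have \<tau>_other: "?\<tau> (int i) \<noteq> 0 \<and> \<bar>?\<tau> (int i)\<bar> \<le> int n \<and> ?\<tau> (int i) \<noteq> int n"
      if "i \<in> {1..n}" "i \<noteq> p" for i
      using range[OF that(1)] other[OF that] by (auto simp: letter_shift_def)
    \<comment> \<open>Replacing the minimum \<open>-1\<close> by the maximum \<open>n\<close> turns
      the ascent at \<open>p\<close> into a descent and, for \<open>p \<noteq> 1\<close>, the
      descent at \<open>p - 1\<close> into an ascent. So one descent moves a single place to the
      right.\<close>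
    have p_notin: "p \<notin> descents n \<sigma>"
      using 2 range[of "p + 1"] \<open>p < n\<close> by (auto simp: descents_def signed_less_def)
    have p_in: "p \<in> descents n ?\<tau>"
      using \<tau>p \<tau>_other[of "p + 1"] \<open>p < n\<close> p by (auto simp: descents_def signed_less_def)
    have pred_in: "p - 1 \<in> descents n \<sigma>" if "p \<noteq> 1"
    proof -
      have r: "p - 1 \<in> {1..n}" "p - 1 \<noteq> p" "p - 1 + 1 = p" "p - 1 < n" using that p by auto
      show ?thesis
        unfolding descents_def signed_less_def
        using r 2 range[OF r(1)] other[OF r(1,2)] by auto
    qed
    have pred_notin: "p - 1 \<notin> descents n ?\<tau>"
    proof
      assume d: "p - 1 \<in> descents n ?\<tau>"
      then have r: "p - 1 \<in> {1..n}" "p - 1 \<noteq> p" "p - 1 + 1 = p" by (auto simp: descents_def)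
      have "signed_less (int n) (?\<tau> (int (p - 1)))"
        using d r(3) \<tau>p by (simp only: descents_def mem_Collect_eq)
      then show False using \<tau>_other[OF r(1,2)] by (auto simp: signed_less_def)
    qed
    have "descents n ?\<tau> = insert p (descents n \<sigma> - {p - 1})"
    proof (rule set_eqI)
      fix i
      show "i \<in> descents n ?\<tau> \<longleftrightarrow> i \<in> insert p (descents n \<sigma> - {p - 1})"
      proof (cases "i = p \<or> i = p - 1")
        case True
        then show ?thesis using p_in pred_notin p by auto
      next
        case False
        have "i \<in> descents n ?\<tau> \<longleftrightarrow> i \<in> descents n \<sigma>"
        proof (rule desc_other, intro impI)
          assume "i \<in> {1..<n}"
          moreover have "i \<noteq> p" "i + 1 \<noteq> p" using False by auto
          ultimately show "\<sigma> (int i) \<noteq> - 1 \<and> \<sigma> (int (i + 1)) \<noteq> - 1"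
            using other[of i] other[of "i + 1"] by auto
        qed
        then show ?thesis using False by auto
      qed
    qed
    moreover have fin: "finite (descents n \<sigma>)" by (simp add: descents_def)
    ultimately have "maj n ?\<tau> = p + \<Sum>(descents n \<sigma> - {p - 1})"
      using p_notin by (simp add: maj_def)
    \<comment> \<open>For \<open>p = 1\<close> there is no descent to move: \<open>p - 1 = 0\<close>
      is not in the descent set, and as a summand it contributes nothing, so the same formula
      holds.\<close>
    moreover have "maj n \<sigma> = (p - 1) + \<Sum>(descents n \<sigma> - {p - 1})"
    proof (cases "p = 1")
      case True
      moreover have "0 \<notin> descents n \<sigma>" by (simp add: descents_def)
      ultimately show ?thesis by (simp add: maj_def)
    next
      case False
      then show ?thesis using sum.remove[OF fin pred_in, of "\<lambda>i. i"] by (simp add: maj_def)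
    qed
    ultimately have "maj n ?\<tau> = maj n \<sigma> + 1" using p by simp
    then show ?thesis using neg by (simp add: fmaj_def)
  qed
qed

lemma fmaj_letter_shift_funpow:
  assumes s: "\<sigma> \<in> signed_perms n" and last: "\<sigma> (int n) = int n" and "k < 2 * n"
  shows "fmaj n ((letter_shift n ^^ k) \<circ> \<sigma>) = fmaj n \<sigma> + k"
  using \<open>k < 2 * n\<close>
proof (induction k)
  case 0
  then show ?case by simp
next
  case (Suc k)
  let ?\<tau> = "(letter_shift n ^^ k) \<circ> \<sigma>"
  have n: "n \<ge> 1" using Suc.prems by simp
  have "?\<tau> \<in> signed_perms n"
    by (intro signed_perms_compose signed_perms_funpow letter_shift_in_signed_perms n s)
  \<comment> \<open>As \<open>Suc k < 2 * n\<close>, the last letter is either positive or at most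
    \<open>-2\<close>.\<close>
  moreover have "?\<tau> (int n) \<noteq> - 1"
    using letter_shift_funpow_last[of k n] Suc.prems last by auto
  ultimately have "fmaj n (letter_shift n \<circ> ?\<tau>) = fmaj n ?\<tau> + 1"
    using n by (intro fmaj_letter_shift)
  then show ?case using Suc by (simp add: comp_def)
qed

section \<open>The recursion from \<open>n\<close> to \<open>Suc n\<close>\<close>

lemma fmaj_Suc:
  assumes "\<sigma> \<in> signed_perms n"
  shows "fmaj (Suc n) \<sigma> = fmaj n \<sigma>"
proof -
  have last: "\<sigma> (int (Suc n)) = int (Suc n)"
    using assms signed_perms_fixing_last by blast
  have "\<not> signed_less (\<sigma> (int (Suc n))) (\<sigma> (int n))" if "n \<noteq> 0"
    using signed_perms_image[OF assms, of "int n"] last that by (auto simp: signed_less_def)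
  then have "descents (Suc n) \<sigma> = descents n \<sigma>"
    by (auto simp: descents_def less_Suc_eq)
  moreover have "{i \<in> {1..Suc n}. \<sigma> (int i) < 0} = {i \<in> {1..n}. \<sigma> (int i) < 0}"
    using last by (auto simp: le_Suc_eq)
  ultimately show ?thesis by (simp add: fmaj_def maj_def neg_def)
qed

text \<open>The powers of the cycle carry the top letter to each letter exactly once, so they
  represent the left cosets of its stabilizer \<open>signed_perms n\<close>.\<close>

lemma bij_betw_signed_perms_Suc:
  "bij_betw (\<lambda>(k, \<sigma>). (letter_shift (Suc n) ^^ k) \<circ> \<sigma>)
     ({..<2 * Suc n} \<times> signed_perms n) (signed_perms (Suc n))"
proof (rule bij_betw_imageI)
  let ?N = "Suc n"
  let ?c = "letter_shift ?N"
  have c: "?c ^^ k \<in> signed_perms ?N" for k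
    by (intro signed_perms_funpow letter_shift_in_signed_perms) simp
  show "inj_on (\<lambda>(k, \<sigma>). (?c ^^ k) \<circ> \<sigma>) ({..<2 * ?N} \<times> signed_perms n)"
  proof (rule inj_onI, unfold split_paired_all,
      simp only: mem_Sigma_iff prod.case prod.inject, elim conjE)
    fix k l \<sigma> \<tau>
    assume k: "k \<in> {..<2 * ?N}" and l: "l \<in> {..<2 * ?N}"
      and \<sigma>: "\<sigma> \<in> signed_perms n" and \<tau>: "\<tau> \<in> signed_perms n"
      and eq: "(?c ^^ k) \<circ> \<sigma> = (?c ^^ l) \<circ> \<tau>"
    have "(?c ^^ k) (int ?N) = (?c ^^ l) (int ?N)"
      using fun_cong[OF eq, of "int ?N"] \<sigma> \<tau> signed_perms_fixing_last by (metis comp_apply)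
    then have "k = l"
      using k l letter_shift_funpow_last[of k ?N] letter_shift_funpow_last[of l ?N]
      by (auto split: if_splits)
    moreover have "\<sigma> = \<tau>"
    proof
      fix i show "\<sigma> i = \<tau> i"
        using fun_cong[OF eq, of i] signed_perms_inj[OF c] \<open>k = l\<close> by simp
    qed
    ultimately show "k = l \<and> \<sigma> = \<tau>" by simp
  qed
  show "(\<lambda>(k, \<sigma>). (?c ^^ k) \<circ> \<sigma>) ` ({..<2 * ?N} \<times> signed_perms n) = signed_perms ?N"
  proof (intro equalityI subsetI)
    fix \<sigma> assume "\<sigma> \<in> (\<lambda>(k, \<sigma>). (?c ^^ k) \<circ> \<sigma>) ` ({..<2 * ?N} \<times> signed_perms n)"
    then obtain k \<tau> where "\<sigma> = (?c ^^ k) \<circ> \<tau>" and \<tau>: "\<tau> \<in> signed_perms n" by auto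
    moreover have "\<tau> \<in> signed_perms ?N" using \<tau> signed_perms_fixing_last by blast
    ultimately show "\<sigma> \<in> signed_perms ?N" using signed_perms_compose[OF c] by simp
  next
    fix \<sigma> assume \<sigma>: "\<sigma> \<in> signed_perms ?N"
    define v where "v = \<sigma> (int ?N)"
    \<comment> \<open>This solves \<open>letter_shift_funpow_last\<close> for the exponent that
      sends the top letter to \<open>v\<close>.\<close>
    define k where "k = nat (if v > 0 then int ?N - v else 2 * int ?N + v)"
    have v: "v \<noteq> 0" "\<bar>v\<bar> \<le> int ?N"
      using signed_perms_image[OF \<sigma>, of "int ?N"] by (auto simp: v_def)
    then have k: "k < 2 * ?N" by (auto simp: k_def nat_less_iff)
    have ckN: "(?c ^^ k) (int ?N) = v"
      unfolding letter_shift_funpow_last[OF k] using v by (auto simp: k_def)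
    have p: "?c ^^ k permutes ({- int ?N..int ?N} - {0})"
      by (rule signed_perms_permutes[OF c])
    define \<tau> where "\<tau> = inv (?c ^^ k) \<circ> \<sigma>"
    have "\<tau> (int ?N) = int ?N"
      unfolding \<tau>_def comp_apply v_def[symmetric] ckN[symmetric] permutes_inverses(2)[OF p] ..
    moreover have "\<tau> \<in> signed_perms ?N"
      unfolding \<tau>_def by (intro signed_perms_compose signed_perms_inv c \<sigma>)
    ultimately have "\<tau> \<in> signed_perms n" using signed_perms_fixing_last by blast
    moreover have "\<sigma> = (?c ^^ k) \<circ> \<tau>"
      using permutes_inverses(1)[OF p] by (simp add: \<tau>_def fun_eq_iff)
    ultimately show "\<sigma> \<in> (\<lambda>(k, \<sigma>). (?c ^^ k) \<circ> \<sigma>) ` ({..<2 * ?N} \<times> signed_perms n)"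
      using k by force
  qed
qed

text \<open>Writing the q-integers as geometric sums avoids division, so the identity makes sense in
  any commutative ring. Along the coset decomposition, sign is multiplicative and
  \<open>fmaj\<close> is additive in \<open>k\<close>, so the double sum splits into a
  product.\<close>

theorem signed_fmaj_sum:
  fixes x :: "'a :: comm_ring_1"
  shows "(\<Sum>\<sigma> \<in> signed_perms n. of_int (sign (abs_perm \<sigma>)) * x ^ fmaj n \<sigma>)
       = (\<Prod>i = 1..n. \<Sum>k<2 * i. ((- 1) ^ (i - 1) * x) ^ k)"
proof (induction n)
  case 0
  show ?case
    by (simp add: signed_perms_0 abs_perm_id[unfolded id_def] sign_id[unfolded id_def]
        fmaj_def maj_def neg_def descents_def)
next
  case (Suc n)
  let ?c = "letter_shift (Suc n)"
  let ?f = "\<lambda>n \<sigma>. of_int (sign (abs_perm \<sigma>)) * x ^ fmaj n \<sigma>"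
  have summand: "?f (Suc n) ((?c ^^ k) \<circ> \<sigma>) = ((- 1) ^ n * x) ^ k * ?f n \<sigma>"
    if k: "k < 2 * Suc n" and \<sigma>: "\<sigma> \<in> signed_perms n" for k \<sigma>
  proof -
    have \<sigma>': "\<sigma> \<in> signed_perms (Suc n)" "\<sigma> (int (Suc n)) = int (Suc n)"
      using \<sigma> signed_perms_fixing_last by blast+
    have "?c ^^ k \<in> signed_perms (Suc n)"
      by (intro signed_perms_funpow letter_shift_in_signed_perms) simp
    then have "sign (abs_perm ((?c ^^ k) \<circ> \<sigma>)) = ((- 1) ^ n) ^ k * sign (abs_perm \<sigma>)"
      using \<sigma>' by (simp only: sign_abs_perm_compose sign_abs_perm_letter_shift_funpow)
    moreover have "fmaj (Suc n) ((?c ^^ k) \<circ> \<sigma>) = fmaj n \<sigma> + k"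
      using fmaj_letter_shift_funpow[OF \<sigma>' k] fmaj_Suc[OF \<sigma>] by simp
    ultimately show ?thesis by (simp add: power_add power_mult_distrib algebra_simps)
  qed
  have "(\<Sum>\<sigma> \<in> signed_perms (Suc n). ?f (Suc n) \<sigma>)
      = (\<Sum>(k, \<sigma>) \<in> {..<2 * Suc n} \<times> signed_perms n. ?f (Suc n) ((?c ^^ k) \<circ> \<sigma>))"
    using sum.reindex_bij_betw[OF bij_betw_signed_perms_Suc, of "?f (Suc n)" n]
    by (simp only: case_prod_unfold)
  also have "\<dots> = (\<Sum>(k, \<sigma>) \<in> {..<2 * Suc n} \<times> signed_perms n. ((- 1) ^ n * x) ^ k * ?f n \<sigma>)"
    by (rule sum.cong[OF refl])
      (use summand in \<open>simp only: mem_Times_iff lessThan_iff case_prod_unfold\<close>)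
  also have "\<dots> = (\<Sum>k<2 * Suc n. ((- 1) ^ n * x) ^ k) * (\<Sum>\<sigma> \<in> signed_perms n. ?f n \<sigma>)"
    by (simp only: sum_product sum.cartesian_product)
  finally show ?case using Suc by (simp add: mult.commute)
qed

theorem theorem6p2:
  fixes n :: nat and q :: "int poly"
  assumes "n \<ge> 1" and "q = monom 1 1"
  shows "(\<Sum>\<sigma> \<in> signed_perms n. of_int (sign (abs_perm \<sigma>)) * q ^ fmaj n \<sigma>)
       = (\<Prod>i = 1..n. q_int (2 * i) ((- 1) ^ (i - 1) * q))"
proof -
  \<comment> \<open>This is what makes the division in \<open>q_int\<close> exact; the two
    polynomials differ in their constant term.\<close>
  have "(- 1) ^ k * q \<noteq> 1" for k :: nat
  proof
    assume "(- 1) ^ k * q = 1"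
    then have "poly ((- 1) ^ k * q) 0 = poly 1 0" by simp
    then show False by (simp add: assms(2) poly_monom)
  qed
  then show ?thesis by (simp add: signed_fmaj_sum q_int_eq_sum)
qed

end
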